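(* Let $M\in\mathbb N$ and $\mathcal A\subset\{0,\dots,M-1\}$ with $1<|\mathcal A|<M$, let $\delta=\log|\mathcal A|/\log M$, and let $\beta=\beta(M,\mathcal A)$ be the fractal uncertainty exponent. Then $$\beta\ \ge\ -\frac{\log r_k}{k\log M}\ \ge\ \frac{2^{-2M^k}}{2k\log M}>0$$ for all $k\in\mathbb N$ such that $$k\ \ge\ \frac1{1-\delta}-\frac{\log\lceil M^{1-\delta}-1\rceil}{(1-\delta)\log M}.$$
   Context: $\mathbb Z_N=\mathbb Z/N\mathbb Z\simeq\{0,\dots,N-1\}$; $\ell^2_N$ is the space of functions $u:\mathbb Z_N\to\mathbb C$ with $\|u\|_{\ell^2_N}^2=\sum_j|u(j)|^2$; $\mathcal F_Nu(j)=\frac1{\sqrt N}\sum_{\ell=0}^{N-1}\exp(-2\pi ij\ell/N)u(\ell)$; $\mathbf 1_X$ is multiplication by the indicator function of $X\subset\mathbb Z_N$. For $N=M^k$: $\mathcal C_k=\{\sum_{j=0}^{k-1}a_jM^j\mid a_0,\dots,a_{k-1}\in\mathcal A\}\subset\mathbb Z_N$ and $r_k=\|\mathbf 1_{\mathcal C_k}\mathcal F_N\mathbf 1_{\mathcal C_k}\|_{\ell^2_N\to\ell^2_N}$. The fractal uncertainty exponent is $\beta(M,\mathcal A)=-\lim_{k\to\infty}\frac{\log r_k}{k\log M}$ (the limit exists). *)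

theory Defs
  imports "HOL-Analysis.Analysis"
begin

text \<open>
  The group of residues modulo \<open>N\<close> is represented by \<open>{..<N}\<close>. A function on it is
  represented by a function \<open>nat \<Rightarrow> complex\<close>, whose values at arguments \<open>\<ge> N\<close> are
  junk: no operator below reads them, and the norm ignores them.
\<close>

definition l2norm :: "nat \<Rightarrow> (nat \<Rightarrow> complex) \<Rightarrow> real" where
  "l2norm N u = L2_set (\<lambda>j. cmod (u j)) {..<N}"

definition dft :: "nat \<Rightarrow> (nat \<Rightarrow> complex) \<Rightarrow> nat \<Rightarrow> complex" where
  "dft N u j = 1 / complex_of_real (sqrt (real N)) *
     (\<Sum>l<N. exp (- 2 * of_real pi * \<i> * of_nat j * of_nat l / of_nat N) * u l)"

definition ind_mult :: "nat set \<Rightarrow> (nat \<Rightarrow> complex) \<Rightarrow> nat \<Rightarrow> complex" where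
  "ind_mult X u j = indicator X j * u j"

text \<open>
  Operator norm on the space of functions modulo \<open>N\<close>. The library constant \<open>onorm\<close>
  needs the space to be a type, whereas here \<open>N\<close> varies. The supremum is only
  meaningful for operators that are linear and well defined modulo junk values.
\<close>

definition l2_opnorm :: "nat \<Rightarrow> ((nat \<Rightarrow> complex) \<Rightarrow> nat \<Rightarrow> complex) \<Rightarrow> real" where
  "l2_opnorm N T = Sup {l2norm N (T u) | u. l2norm N u \<le> 1}"

text \<open>For \<open>A \<subseteq> {..<M}\<close> these sums are \<open>< M ^ k\<close>, so no reduction modulo \<open>M ^ k\<close> is needed.\<close>

definition cantor_set :: "nat \<Rightarrow> nat set \<Rightarrow> nat \<Rightarrow> nat set" where
  "cantor_set M A k = {\<Sum>j<k. a j * M ^ j | a. \<forall>j<k. a j \<in> A}"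

definition cantor_norm :: "nat \<Rightarrow> nat set \<Rightarrow> nat \<Rightarrow> real" where
  "cantor_norm M A k =
     l2_opnorm (M ^ k)
       (ind_mult (cantor_set M A k) \<circ> dft (M ^ k) \<circ> ind_mult (cantor_set M A k))"

definition fup_exponent :: "nat \<Rightarrow> nat set \<Rightarrow> real" where
  "fup_exponent M A = - lim (\<lambda>k. ln (cantor_norm M A k) / (real k * ln (real M)))"

end

theory Submission
  imports Defs "HOL-Computational_Algebra.Polynomial"
begin

text \<open>
  For \<open>A \<subseteq> {..<M}\<close> let \<open>C k\<close> be the Cantor set in the residues modulo \<open>N = M ^ k\<close>, and let \<open>r k\<close>
  be the norm of the Fourier transform compressed to \<open>C k\<close> on both sides. Two independent facts
  give the theorem.

  The first is submultiplicativity, \<open>r (k + l) \<le> r k * r l\<close> (\<open>cantor_norm_add_le\<close>). The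
  Cooley--Tukey factorization writes the transform of length \<open>M ^ (k + l)\<close> as transforms of
  length \<open>M ^ l\<close>, a multiplication by numbers of modulus 1, and transforms of length \<open>M ^ k\<close>.
  Cutting a base-\<open>M\<close> expansion in two turns \<open>C (k + l)\<close> into a product of \<open>C k\<close> and \<open>C l\<close>, so
  each stage costs one factor of the product. Since \<open>r k \<ge> M powr (- k / 2)\<close>, the sequence \<open>ln (r k)\<close> is
  subadditive with a linear lower bound. By Fekete's lemma \<open>ln (r k) / k\<close> converges to its
  infimum, and therefore every single \<open>k\<close> bounds the exponent from below (\<open>fup_exponent_lower\<close>).

  The second is a quantitative form of \<open>r k < 1\<close> (\<open>cantor_norm_gap\<close>). By pigeonhole some cyclic
  run of \<open>L = \<lceil>M / card A - 1\<rceil>\<close> digits avoids \<open>A\<close>. Used as leading digits, these give a cyclic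
  interval of \<open>L * M ^ (k - 1)\<close> residues that avoids \<open>C k\<close>. The threshold on \<open>k\<close> says exactly that
  this interval has at least \<open>card A ^ k\<close> elements, an upper bound for \<open>card (C k)\<close>. The
  values of the transform of a function \<open>u\<close> supported on \<open>C k\<close> at that many consecutive points determine \<open>u\<close>,
  because the linear system is of Vandermonde type. Made explicit (\<open>restricted_dft_recover_value\<close>),
  this says that a proportion of at least \<open>1 / 4 ^ N\<close> of the energy of the transform of \<open>u\<close> lies
  outside \<open>C k\<close>. By Parseval's identity \<open>(r k)\<^sup>2 \<le> 1 - 1 / 4 ^ N\<close>, and taking logarithms yields
  the explicit bound.
\<close>

section \<open>Roots of unity and Parseval's identity\<close>

definition unity_root :: "nat \<Rightarrow> nat \<Rightarrow> complex" where
  "unity_root N l = cis (- (2 * pi * real l / real N))"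

text \<open>
  The sum runs over \<open>X\<close> instead of a full period, and \<open>j\<close> is not reduced modulo \<open>N\<close>. This makes the
  values at consecutive points \<open>s, s + 1, \<dots>\<close> an exponential sum even when the points wrap around.
\<close>

definition restricted_dft :: "nat \<Rightarrow> nat set \<Rightarrow> (nat \<Rightarrow> complex) \<Rightarrow> nat \<Rightarrow> complex" where
  "restricted_dft N X u j = (\<Sum>l\<in>X. unity_root N l ^ j * u l) / complex_of_real (sqrt (real N))"

lemma norm_unity_root [simp]: "cmod (unity_root N l) = 1"
  by (simp add: unity_root_def)

lemma unity_root_power_order:
  assumes "N > 0"
  shows "unity_root N l ^ N = 1"
proof -
  have "unity_root N l ^ N = cnj (cis (2 * pi * real l))"
    using assms by (simp add: unity_root_def cis_cnj Complex.DeMoivre field_simps)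
  also have "cis (2 * pi * real l) = 1"
    by (metis cis_multiple_2pi mult.commute Ints_of_nat)
  finally show ?thesis by simp
qed

lemma unity_root_power_mod:
  assumes "N > 0"
  shows "unity_root N l ^ (j mod N) = unity_root N l ^ j"
proof -
  have "unity_root N l ^ j = unity_root N l ^ (N * (j div N) + j mod N)"
    by simp
  also have "\<dots> = unity_root N l ^ (j mod N)"
    by (simp only: power_add power_mult unity_root_power_order[OF assms]) simp
  finally show ?thesis ..
qed

lemma inj_on_unity_root:
  assumes "N > 0"
  shows "inj_on (unity_root N) {..<N}"
proof -
  have "inj_on (\<lambda>l. cis (2 * pi * real l / real N)) {..<N}"
    using Complex.bij_betw_roots_unity[OF assms] by (simp add: bij_betw_def)
  moreover have "unity_root N l = cnj (cis (2 * pi * real l / real N))" for l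
    by (simp add: unity_root_def cis_cnj)
  ultimately show ?thesis
    by (auto simp: inj_on_def)
qed

lemma unity_root_power: "unity_root N l ^ j = cis (- (2 * pi * (real j * real l) / real N))"
  by (simp add: unity_root_def Complex.DeMoivre algebra_simps)

lemma sum_unity_root_orthogonal:
  assumes "N > 0" "l < N" "m < N"
  shows "(\<Sum>j<N. unity_root N l ^ j * cnj (unity_root N m ^ j)) = (if l = m then of_nat N else 0)"
proof (cases "l = m")
  case True
  have "unity_root N m ^ j * cnj (unity_root N m ^ j) = 1" for j
    by (simp only: complex_norm_square[symmetric]) (simp add: norm_power)
  with True show ?thesis by (simp del: complex_cnj_power)
next
  case False
  define z where "z = unity_root N l * cnj (unity_root N m)"
  have "z \<noteq> 1"
  proof
    assume "z = 1"
    then have "z * unity_root N m = unity_root N m" by simp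
    moreover have "cnj (unity_root N m) * unity_root N m = 1"
      by (simp only: complex_norm_square[symmetric] mult.commute[of "cnj _"]) simp
    ultimately have "unity_root N l = unity_root N m"
      by (simp add: z_def mult.assoc)
    with False assms inj_on_unity_root[of N] show False
      by (auto dest: inj_onD)
  qed
  moreover have "z ^ N = 1"
    using assms by (simp add: z_def power_mult_distrib unity_root_power_order flip: complex_cnj_power)
  ultimately have "(\<Sum>j<N. z ^ j) = 0"
    by (simp add: sum_gp_strict)
  with False show ?thesis
    by (simp add: z_def power_mult_distrib)
qed

lemma parseval:
  assumes "N > 0" "X \<subseteq> {..<N}"
  shows "(\<Sum>j<N. (cmod (restricted_dft N X u j))\<^sup>2) = (\<Sum>l\<in>X. (cmod (u l))\<^sup>2)"
proof -
  let ?w = "unity_root N"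
  have fin: "finite X" using assms(2) finite_subset by blast
  have sq: "complex_of_real (sqrt (real N)) * complex_of_real (sqrt (real N)) = of_nat N"
    by (metis of_nat_0_le_iff of_real_mult of_real_of_nat_eq real_sqrt_mult_self abs_of_nat)
  have "(\<Sum>j<N. restricted_dft N X u j * cnj (restricted_dft N X u j))
      = (\<Sum>j<N. \<Sum>l\<in>X. \<Sum>m\<in>X. (?w l ^ j * cnj (?w m ^ j)) * (u l * cnj (u m)) / of_nat N)"
    by (rule sum.cong)
       (simp_all add: restricted_dft_def sum_product sum_divide_distrib mult_ac sq)
  also have "\<dots> = (\<Sum>l\<in>X. \<Sum>j<N. \<Sum>m\<in>X. (?w l ^ j * cnj (?w m ^ j)) * (u l * cnj (u m)) / of_nat N)"
    by (rule sum.swap)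
  also have "\<dots> = (\<Sum>l\<in>X. \<Sum>m\<in>X. \<Sum>j<N. (?w l ^ j * cnj (?w m ^ j)) * (u l * cnj (u m)) / of_nat N)"
    by (intro sum.cong refl sum.swap)
  also have "\<dots> = (\<Sum>l\<in>X. \<Sum>m\<in>X. if l = m then u l * cnj (u m) else 0)"
  proof (intro sum.cong refl)
    fix l m assume "l \<in> X" "m \<in> X"
    then have lm: "l < N" "m < N" using assms by auto
    have "(\<Sum>j<N. (?w l ^ j * cnj (?w m ^ j)) * (u l * cnj (u m)) / of_nat N)
        = (\<Sum>j<N. ?w l ^ j * cnj (?w m ^ j)) * (u l * cnj (u m)) / of_nat N"
      by (simp only: sum_distrib_right sum_divide_distrib)
    then show "(\<Sum>j<N. (?w l ^ j * cnj (?w m ^ j)) * (u l * cnj (u m)) / of_nat N)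
        = (if l = m then u l * cnj (u m) else 0)"
      unfolding sum_unity_root_orthogonal[OF assms(1) lm] using assms(1) by simp
  qed
  also have "\<dots> = (\<Sum>l\<in>X. u l * cnj (u l))"
    using fin by simp
  finally have "complex_of_real (\<Sum>j<N. (cmod (restricted_dft N X u j))\<^sup>2)
      = complex_of_real (\<Sum>l\<in>X. (cmod (u l))\<^sup>2)"
    by (simp only: of_real_sum complex_norm_square)
  then show ?thesis
    by (simp only: of_real_eq_iff)
qed

section \<open>Recovering a function from consecutive Fourier coefficients\<close>

text \<open>
  Both sides are the modulus of the derivative of \<open>X ^ N - 1\<close> at the root \<open>unity_root N l\<close>,
  computed once from its linear factors and once directly.
\<close>

lemma prod_dist_unity_roots:
  assumes "N > 0" "l < N"
  shows "(\<Prod>m\<in>{..<N} - {l}. cmod (unity_root N l - unity_root N m)) = real N"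
proof -
  let ?w = "unity_root N"
  let ?S = "{..<N} - {l}"
  define P where "P = (\<Prod>m\<in>?S. [:- ?w m, 1:])"
  have prod_eq: "(\<Prod>m<N. [:- ?w m, 1:]) = monom 1 N - 1"
  proof (rule poly_eqI_degree_lead_coeff)
    have deg: "degree (\<Prod>m<N. [:- ?w m, 1:]) = N"
      by (subst degree_prod_eq_sum_degree) simp_all
    have "lead_coeff (\<Prod>m<N. [:- ?w m, 1:]) = 1"
      by (simp add: lead_coeff_prod)
    with deg assms show "coeff (\<Prod>m<N. [:- ?w m, 1:]) N = coeff (monom 1 N - 1) N"
      by simp
    show "N \<le> card (?w ` {..<N})"
      using inj_on_unity_root[OF assms(1)] by (simp add: card_image)
    show "degree (\<Prod>m<N. [:- ?w m, 1:]) \<le> N"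
      using deg by simp
    show "degree (monom 1 N - (1 :: complex poly)) \<le> N"
      by (intro degree_diff_le) (simp_all add: degree_monom_le)
    show "poly (\<Prod>m<N. [:- ?w m, 1:]) z = poly (monom 1 N - 1) z" if "z \<in> ?w ` {..<N}" for z
      using that assms by (auto simp: poly_prod poly_monom unity_root_power_order)
  qed
  have "(\<Prod>m<N. [:- ?w m, 1:]) = [:- ?w l, 1:] * P"
    unfolding P_def using assms by (subst prod.remove[of _ l]) auto
  then have "poly (pderiv (monom 1 N - 1)) (?w l) = poly (pderiv ([:- ?w l, 1:] * P)) (?w l)"
    by (simp add: prod_eq)
  also have "\<dots> = poly P (?w l)"
    by (simp only: pderiv_mult) (simp add: pderiv_pCons)
  finally have "poly P (?w l) = of_nat N * ?w l ^ (N - 1)"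
    by (simp add: pderiv_diff pderiv_monom poly_monom)
  then have "cmod (poly P (?w l)) = real N"
    by (simp add: norm_mult norm_power)
  then show ?thesis
    by (simp add: P_def poly_prod prod_norm)
qed

text \<open>
  This isolates one coefficient of an exponential sum, that is, it inverts a Vandermonde system with an explicit
  bound. The operator that maps a sequence \<open>v\<close> to \<open>\<lambda>t. v (t + 1) - w s * v t\<close> annihilates the
  frequency \<open>w s\<close>, multiplies the coefficient at \<open>w m\<close> by \<open>w m - w s\<close>, at most doubles a bound on
  the sequence, and shortens the range of available points by one. Applying it for every \<open>s\<close> in \<open>S\<close>
  leaves only the coefficient at \<open>l\<close>.
\<close>

lemma exponential_sum_coeff_bound:
  fixes w c :: "'a \<Rightarrow> complex"
  assumes "finite S" "l \<notin> S"
    and "\<And>m. m \<in> S \<Longrightarrow> cmod (w m) \<le> 1"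
    and "\<And>t. t \<le> card S \<Longrightarrow> cmod (\<Sum>m\<in>insert l S. w m ^ t * c m) \<le> B"
  shows "cmod (c l) * (\<Prod>m\<in>S. cmod (w l - w m)) \<le> 2 ^ card S * B"
  using assms
proof (induction S arbitrary: c B rule: finite_induct)
  case empty
  from empty.prems(3)[of 0] show ?case by simp
next
  case (insert s S)
  let ?v = "\<lambda>t. \<Sum>m\<in>insert l (insert s S). w m ^ t * c m"
  let ?c = "\<lambda>m. (w m - w s) * c m"
  have "cmod (\<Sum>m\<in>insert l S. w m ^ t * ?c m) \<le> 2 * B" if t: "t \<le> card S" for t
  proof -
    \<comment> \<open>The term at \<open>m = s\<close> vanishes and drops out.\<close>
    have "?v (Suc t) - w s * ?v t = (\<Sum>m\<in>insert l (insert s S). w m ^ t * ?c m)"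
      by (simp only: sum_distrib_left flip: sum_subtractf) (simp add: algebra_simps)
    also have "\<dots> = (\<Sum>m\<in>insert l S. w m ^ t * ?c m)"
      unfolding insert_commute[of l s] using insert.hyps insert.prems(1) by (subst sum.insert) auto
    finally have "cmod (\<Sum>m\<in>insert l S. w m ^ t * ?c m) = cmod (?v (Suc t) - w s * ?v t)"
      by (simp only:)
    also have "\<dots> \<le> cmod (?v (Suc t)) + cmod (w s) * cmod (?v t)"
      unfolding norm_mult[symmetric] by (rule norm_triangle_ineq4)
    also have "\<dots> \<le> B + 1 * B"
      using insert.hyps t insert.prems(3)[of "Suc t"] insert.prems(3)[of t] insert.prems(2)[of s]
      by (intro add_mono mult_mono) auto
    finally show ?thesis by simp
  qed
  then have "cmod (?c l) * (\<Prod>m\<in>S. cmod (w l - w m)) \<le> 2 ^ card S * (2 * B)"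
    using insert.prems by (intro insert.IH) auto
  then show ?case
    using insert.hyps by (simp add: norm_mult mult_ac)
qed

lemma restricted_dft_mod:
  assumes "N > 0"
  shows "restricted_dft N X u (j mod N) = restricted_dft N X u j"
  by (simp add: restricted_dft_def unity_root_power_mod[OF assms])

text \<open>
  Isolating the coefficient at \<open>l\<close> costs the reciprocal of the product of the distances from the
  root \<open>unity_root N l\<close> to the roots indexed by the rest of \<open>X\<close>. Individual distances may be small, but the
  product over all \<open>N - 1\<close> other roots is \<open>N\<close>, and the factors outside \<open>X\<close> are at most 2 each.
\<close>

lemma restricted_dft_recover_value:
  assumes N: "N > 0" and X: "X \<subseteq> {..<N}" and l: "l \<in> X"
    and B: "\<And>t. t < card X \<Longrightarrow> cmod (restricted_dft N X u (s + t)) \<le> B"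
  shows "sqrt (real N) * cmod (u l) \<le> 2 ^ (N - 1) * B"
proof -
  let ?w = "unity_root N"
  let ?d = "\<lambda>m. cmod (?w l - ?w m)"
  define S where "S = X - {l}"
  define r where "r = sqrt (real N)"
  have r: "r > 0" "r * r = real N" using N by (auto simp: r_def)
  have fin: "finite X" using X finite_subset by blast
  have cS: "card X = Suc (card S)"
    using fin l by (simp add: S_def card_Suc_Diff1 del: card_Diff_singleton card_Diff_insert)
  have cX: "card X \<le> N" using card_mono[OF _ X] by simp
  have B0: "B \<ge> 0" using order_trans[OF norm_ge_zero B[of 0]] cS by simp
  have ins: "insert l S = X" using l by (auto simp: S_def)
  have "cmod (?w l ^ s * u l) * (\<Prod>m\<in>S. ?d m) \<le> 2 ^ card S * (r * B)"
  proof (rule exponential_sum_coeff_bound)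
    fix t assume "t \<le> card S"
    then have "cmod (restricted_dft N X u (s + t)) \<le> B" using B cS by simp
    then have "cmod (\<Sum>m\<in>X. ?w m ^ (s + t) * u m) \<le> r * B"
      using r by (simp add: restricted_dft_def norm_divide field_simps flip: r_def)
    then show "cmod (\<Sum>m\<in>insert l S. ?w m ^ t * (?w m ^ s * u m)) \<le> r * B"
      unfolding ins by (simp add: power_add mult_ac)
  qed (use fin in \<open>auto simp: S_def\<close>)
  then have main: "cmod (u l) * (\<Prod>m\<in>S. ?d m) \<le> 2 ^ card S * (r * B)"
    by (simp add: norm_mult norm_power)
  have "(\<Prod>m\<in>{..<N} - X. ?d m) \<le> (\<Prod>m\<in>{..<N} - X. 2)"
    by (intro prod_mono conjI norm_ge_zero order_trans[OF norm_triangle_ineq4]) simp_all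
  also have "\<dots> = 2 ^ (N - card X)"
    using X fin by (simp add: card_Diff_subset)
  finally have rest: "(\<Prod>m\<in>{..<N} - X. ?d m) \<le> 2 ^ (N - card X)" .
  have "real N = (\<Prod>m\<in>{..<N} - {l}. ?d m)"
    using prod_dist_unity_roots[OF N] l X by auto
  also have "{..<N} - {l} = S \<union> ({..<N} - X)"
    using X l by (auto simp: S_def)
  also have "(\<Prod>m\<in>S \<union> ({..<N} - X). ?d m) = (\<Prod>m\<in>S. ?d m) * (\<Prod>m\<in>{..<N} - X. ?d m)"
    using fin by (intro prod.union_disjoint) (auto simp: S_def)
  finally have "cmod (u l) * real N = (cmod (u l) * (\<Prod>m\<in>S. ?d m)) * (\<Prod>m\<in>{..<N} - X. ?d m)"
    by simp
  also have "\<dots> \<le> (2 ^ card S * (r * B)) * 2 ^ (N - card X)"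
    by (rule mult_mono[OF main rest]) (use r B0 in \<open>auto intro!: prod_nonneg\<close>)
  also have "\<dots> = 2 ^ (card S + (N - card X)) * (r * B)"
    by (simp add: power_add)
  also have "card S + (N - card X) = N - 1"
    using cS cX by simp
  finally have "r * (r * cmod (u l)) \<le> r * (2 ^ (N - 1) * B)"
    by (simp add: mult_ac flip: r(2))
  then show ?thesis
    using r(1) by (simp flip: r_def)
qed

text \<open>
  The values of the transform on the cyclic interval recover every \<open>u l\<close>. So the energy
  outside \<open>X\<close> is at least \<open>1 / 4 ^ N\<close> of the total, which Parseval's identity equates with the energy of \<open>u\<close>.
\<close>

lemma restricted_dft_energy_gap:
  assumes N: "N > 0" and X: "X \<subseteq> {..<N}"
    and gap: "\<And>t. t < card X \<Longrightarrow> (s + t) mod N \<notin> X"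
  shows "(\<Sum>j\<in>X. (cmod (restricted_dft N X u j))\<^sup>2)
           \<le> (1 - 1 / 4 ^ N) * (\<Sum>l\<in>X. (cmod (u l))\<^sup>2)"
proof -
  let ?v = "restricted_dft N X u"
  let ?E = "\<Sum>l\<in>X. (cmod (u l))\<^sup>2"
  define G where "G = (\<Sum>j\<in>{..<N} - X. (cmod (?v j))\<^sup>2)"
  have fin: "finite X" using X finite_subset by blast
  have cX: "card X \<le> N" using card_mono[OF _ X] by simp
  have G0: "G \<ge> 0" by (simp add: G_def sum_nonneg)
  have B: "cmod (?v (s + t)) \<le> sqrt G" if "t < card X" for t
  proof -
    have "(s + t) mod N \<in> {..<N} - X" using gap[OF that] N by simp
    then have "(cmod (?v ((s + t) mod N)))\<^sup>2 \<le> G"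
      unfolding G_def by (rule member_le_sum) auto
    then show ?thesis
      by (simp add: restricted_dft_mod[OF N] real_le_rsqrt)
  qed
  have pow: "((2::real) ^ (N - 1))\<^sup>2 = 4 ^ (N - 1)"
    by (simp add: power2_eq_square flip: power_mult_distrib)
  have pt: "real N * (cmod (u l))\<^sup>2 \<le> 4 ^ N * G" if "l \<in> X" for l
  proof -
    have "(sqrt (real N) * cmod (u l))\<^sup>2 \<le> (2 ^ (N - 1) * sqrt G)\<^sup>2"
      using restricted_dft_recover_value[OF N X that B] by (intro power_mono) auto
    also have "\<dots> = 4 ^ (N - 1) * G"
      using G0 pow by (simp add: power_mult_distrib del: One_nat_def)
    also have "\<dots> \<le> 4 ^ N * G"
      using G0 by (intro mult_right_mono power_increasing) auto
    finally show ?thesis by (simp add: power_mult_distrib)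
  qed
  have "real N * ?E = (\<Sum>l\<in>X. real N * (cmod (u l))\<^sup>2)"
    by (simp add: sum_distrib_left)
  also have "\<dots> \<le> (\<Sum>l\<in>X. 4 ^ N * G)"
    by (intro sum_mono pt)
  also have "\<dots> \<le> real N * (4 ^ N * G)"
    using cX G0 by (simp add: mult_right_mono)
  finally have "?E \<le> 4 ^ N * G"
    using N by simp
  then have "?E / 4 ^ N \<le> G"
    by (simp add: divide_le_eq mult.commute)
  moreover have "(\<Sum>j<N. (cmod (?v j))\<^sup>2) = G + (\<Sum>j\<in>X. (cmod (?v j))\<^sup>2)"
    unfolding G_def by (rule sum.subset_diff[OF X]) simp
  then have "?E = G + (\<Sum>j\<in>X. (cmod (?v j))\<^sup>2)"
    unfolding parseval[OF N X] .
  ultimately have "(\<Sum>j\<in>X. (cmod (?v j))\<^sup>2) \<le> ?E - ?E / 4 ^ N"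
    by linarith
  also have "\<dots> = (1 - 1 / 4 ^ N) * ?E"
    by (simp add: left_diff_distrib)
  finally show ?thesis .
qed

section \<open>The norm of the compressed Fourier transform\<close>

abbreviation masked_dft :: "nat \<Rightarrow> nat set \<Rightarrow> (nat \<Rightarrow> complex) \<Rightarrow> nat \<Rightarrow> complex" where
  "masked_dft N X \<equiv> ind_mult X \<circ> dft N \<circ> ind_mult X"

lemma masked_dft_eq:
  assumes "X \<subseteq> {..<N}"
  shows "masked_dft N X u j = indicator X j * restricted_dft N X u j"
proof -
  have e: "exp (- 2 * of_real pi * \<i> * of_nat j * of_nat l / of_nat N) = unity_root N l ^ j" for l
    unfolding unity_root_power cis_conv_exp by (rule arg_cong[of _ _ exp]) (simp add: mult_ac)
  have "dft N v j = (\<Sum>l<N. unity_root N l ^ j * v l) / complex_of_real (sqrt (real N))" for v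
    unfolding dft_def e by simp
  moreover have "(\<Sum>l<N. unity_root N l ^ j * (indicator X l * u l)) = (\<Sum>l\<in>X. unity_root N l ^ j * u l)"
    using assms by (intro sum.mono_neutral_cong_right) auto
  ultimately show ?thesis
    by (simp add: ind_mult_def restricted_dft_def)
qed

lemma l2norm_masked_dft:
  assumes "X \<subseteq> {..<N}"
  shows "(l2norm N (masked_dft N X u))\<^sup>2
           = (\<Sum>j\<in>X. (cmod (restricted_dft N X u j))\<^sup>2)"
proof -
  have "(\<Sum>j<N. (cmod (indicator X j * restricted_dft N X u j))\<^sup>2)
      = (\<Sum>j\<in>X. (cmod (restricted_dft N X u j))\<^sup>2)"
    using assms by (intro sum.mono_neutral_cong_right) auto
  then show ?thesis
    by (simp add: l2norm_def L2_set_def masked_dft_eq[OF assms] sum_nonneg del: comp_apply)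
qed

lemma masked_opnorm_le:
  assumes X: "X \<subseteq> {..<N}" and c: "c \<ge> 0"
    and bound: "\<And>u. (\<Sum>j\<in>X. (cmod (restricted_dft N X u j))\<^sup>2) \<le> c\<^sup>2 * (\<Sum>l\<in>X. (cmod (u l))\<^sup>2)"
  shows "l2_opnorm N (masked_dft N X) \<le> c"
  unfolding l2_opnorm_def
proof (rule cSup_least)
  have "l2norm N (\<lambda>_. 0) \<le> 1" by (simp add: l2norm_def L2_set_def)
  then show "{l2norm N (masked_dft N X u) |u. l2norm N u \<le> 1} \<noteq> {}" by blast
next
  fix x assume "x \<in> {l2norm N (masked_dft N X u) |u. l2norm N u \<le> 1}"
  then obtain u where x: "x = l2norm N (masked_dft N X u)" and u: "l2norm N u \<le> 1"
    by blast
  have "(\<Sum>l\<in>X. (cmod (u l))\<^sup>2) \<le> (\<Sum>l<N. (cmod (u l))\<^sup>2)"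
    using X by (intro sum_mono2) auto
  also have "\<dots> \<le> 1"
    using u by (simp add: l2norm_def L2_set_def)
  finally have "(\<Sum>l\<in>X. (cmod (u l))\<^sup>2) \<le> 1" .
  then have "c\<^sup>2 * (\<Sum>l\<in>X. (cmod (u l))\<^sup>2) \<le> c\<^sup>2 * 1"
    by (rule mult_left_mono) simp
  with bound[of u] have "x\<^sup>2 \<le> c\<^sup>2"
    unfolding x l2norm_masked_dft[OF X] by simp
  then show "x \<le> c" using c by (rule power2_le_imp_le)
qed

text \<open>
  The supremum that defines the norm is over a bounded set because the Fourier transform is an
  isometry and the two masks do not increase the norm.
\<close>

lemma masked_opnorm_upper:
  assumes N: "N > 0" and X: "X \<subseteq> {..<N}" and u: "l2norm N u \<le> 1"
  shows "l2norm N (masked_dft N X u)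
           \<le> l2_opnorm N (masked_dft N X)"
  unfolding l2_opnorm_def
proof (rule cSup_upper)
  show "bdd_above {l2norm N (masked_dft N X u) |u. l2norm N u \<le> 1}"
  proof (rule bdd_aboveI, clarify)
    fix u assume u: "l2norm N u \<le> 1"
    have "(l2norm N (masked_dft N X u))\<^sup>2
        \<le> (\<Sum>j<N. (cmod (restricted_dft N X u j))\<^sup>2)"
      unfolding l2norm_masked_dft[OF X] using X by (intro sum_mono2) auto
    also have "\<dots> \<le> (\<Sum>l<N. (cmod (u l))\<^sup>2)"
      unfolding parseval[OF N X] using X by (intro sum_mono2) auto
    also have "\<dots> \<le> 1\<^sup>2"
      using u by (simp add: l2norm_def L2_set_def)
    finally show "l2norm N (masked_dft N X u) \<le> 1"
      by (rule power2_le_imp_le) simp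
  qed
qed (use u in blast)

lemma masked_opnorm_nonneg:
  assumes "N > 0" "X \<subseteq> {..<N}"
  shows "l2_opnorm N (masked_dft N X) \<ge> 0"
proof -
  have zero: "l2norm N (\<lambda>_. 0) \<le> 1" by (simp add: l2norm_def L2_set_def)
  have "0 \<le> l2norm N (masked_dft N X (\<lambda>_. 0))"
    by (simp add: l2norm_def)
  also note masked_opnorm_upper[OF assms zero]
  finally show ?thesis .
qed

text \<open>
  The converse of \<open>masked_opnorm_le\<close>, by scaling \<open>u\<close> to a unit vector. The values of \<open>u\<close> outside \<open>X\<close> are
  discarded first, so that the energy on \<open>X\<close> is the full norm.
\<close>

lemma masked_opnorm_bound:
  assumes N: "N > 0" and X: "X \<subseteq> {..<N}"
  shows "(\<Sum>j\<in>X. (cmod (restricted_dft N X u j))\<^sup>2)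
           \<le> (l2_opnorm N (masked_dft N X))\<^sup>2 * (\<Sum>l\<in>X. (cmod (u l))\<^sup>2)"
    (is "?L \<le> ?r\<^sup>2 * ?E")
proof (cases "?E = 0")
  case True
  have "?L \<le> (\<Sum>j<N. (cmod (restricted_dft N X u j))\<^sup>2)"
    using X by (intro sum_mono2) auto
  with True show ?thesis
    by (simp only: parseval[OF N X] True mult_zero_right)
next
  case False
  define s where "s = sqrt ?E"
  have "?E > 0" using False by (simp add: less_le sum_nonneg)
  then have s: "s > 0" "s\<^sup>2 = ?E" by (simp_all add: s_def)
  define v where "v = (\<lambda>l. indicator X l * u l / complex_of_real s)"
  have "(\<Sum>l<N. (cmod (v l))\<^sup>2) = (\<Sum>l\<in>X. (cmod (u l))\<^sup>2 / s\<^sup>2)"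
    using X by (intro sum.mono_neutral_cong_right) (auto simp: v_def norm_divide power_divide)
  also have "\<dots> = 1"
    using s False by (simp flip: sum_divide_distrib)
  finally have "l2norm N v \<le> 1"
    by (simp add: l2norm_def L2_set_def)
  then have le: "l2norm N (masked_dft N X v) \<le> ?r"
    by (rule masked_opnorm_upper[OF N X])
  have "restricted_dft N X v j = restricted_dft N X u j / complex_of_real s" for j
  proof -
    have "(\<Sum>l\<in>X. unity_root N l ^ j * v l) = (\<Sum>l\<in>X. unity_root N l ^ j * u l) / complex_of_real s"
      unfolding sum_divide_distrib by (rule sum.cong) (simp_all add: v_def)
    then show ?thesis by (simp add: restricted_dft_def)
  qed
  then have "(\<Sum>j\<in>X. (cmod (restricted_dft N X v j))\<^sup>2) = ?L / s\<^sup>2"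
    by (simp add: norm_divide power_divide sum_divide_distrib)
  moreover have "(l2norm N (masked_dft N X v))\<^sup>2 \<le> ?r\<^sup>2"
    using le by (intro power_mono) (simp_all add: l2norm_def)
  ultimately have "?L / s\<^sup>2 \<le> ?r\<^sup>2"
    by (simp only: l2norm_masked_dft[OF X])
  then show ?thesis
    unfolding s(2) using \<open>?E > 0\<close> by (simp add: pos_divide_le_eq)
qed

text \<open>
  Witnessed by a point mass, whose transform has modulus \<open>1 / sqrt (real N)\<close> everywhere.
\<close>

lemma masked_opnorm_lower:
  assumes N: "N > 0" and X: "X \<subseteq> {..<N}" and x: "x \<in> X"
  shows "l2_opnorm N (masked_dft N X) \<ge> 1 / sqrt (real N)"
    (is "?r \<ge> _")
proof -
  define u :: "nat \<Rightarrow> complex" where "u = (\<lambda>l. if l = x then 1 else 0)"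
  have fin: "finite X" using X finite_subset by blast
  have "(\<Sum>l\<in>X. (cmod (u l))\<^sup>2) = (\<Sum>l\<in>X. if l = x then 1 else 0)"
    by (rule sum.cong) (simp_all add: u_def)
  then have E: "(\<Sum>l\<in>X. (cmod (u l))\<^sup>2) = 1"
    using fin x by simp
  have "(\<Sum>l\<in>X. unity_root N l ^ x * u l) = (\<Sum>l\<in>X. if l = x then unity_root N l ^ x else 0)"
    by (rule sum.cong) (simp_all add: u_def)
  then have "cmod (restricted_dft N X u x) = 1 / sqrt (real N)"
    using fin x by (simp add: restricted_dft_def norm_divide norm_power)
  then have "(1 / sqrt (real N))\<^sup>2 = (cmod (restricted_dft N X u x))\<^sup>2" by simp
  also have "\<dots> \<le> (\<Sum>j\<in>X. (cmod (restricted_dft N X u j))\<^sup>2)"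
    using fin x by (intro member_le_sum) auto
  also have "\<dots> \<le> ?r\<^sup>2"
    using masked_opnorm_bound[OF N X, of u] by (simp add: E)
  finally show ?thesis
    by (rule power2_le_imp_le) (rule masked_opnorm_nonneg[OF N X])
qed

section \<open>Cantor sets\<close>

lemma sum_lessThan_add_split:
  fixes f :: "nat \<Rightarrow> 'a :: comm_monoid_add"
  shows "(\<Sum>j<k + l. f j) = (\<Sum>j<k. f j) + (\<Sum>j<l. f (k + j))"
  by (induction l) (simp_all add: add.assoc)

lemma cantor_set_add:
  "cantor_set M A (k + l) = (\<lambda>(a, b). M ^ k * a + b) ` (cantor_set M A l \<times> cantor_set M A k)"
proof (intro equalityI subsetI)
  fix x assume "x \<in> cantor_set M A (k + l)"
  then obtain a where a: "\<forall>j<k + l. a j \<in> A" and x: "x = (\<Sum>j<k + l. a j * M ^ j)"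
    by (auto simp: cantor_set_def)
  have "x = M ^ k * (\<Sum>j<l. a (k + j) * M ^ j) + (\<Sum>j<k. a j * M ^ j)"
    unfolding x sum_lessThan_add_split by (simp add: sum_distrib_left power_add mult_ac)
  moreover have "(\<Sum>j<l. a (k + j) * M ^ j) \<in> cantor_set M A l"
    unfolding cantor_set_def using a by (intro CollectI exI[of _ "\<lambda>j. a (k + j)"]) auto
  moreover have "(\<Sum>j<k. a j * M ^ j) \<in> cantor_set M A k"
    unfolding cantor_set_def using a by (intro CollectI exI[of _ a]) auto
  ultimately show "x \<in> (\<lambda>(a, b). M ^ k * a + b) ` (cantor_set M A l \<times> cantor_set M A k)"
    by auto
next
  fix x assume "x \<in> (\<lambda>(a, b). M ^ k * a + b) ` (cantor_set M A l \<times> cantor_set M A k)"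
  then obtain a b where a: "\<forall>j<l. a j \<in> A" and b: "\<forall>j<k. b j \<in> A"
    and x: "x = M ^ k * (\<Sum>j<l. a j * M ^ j) + (\<Sum>j<k. b j * M ^ j)"
    by (auto simp: cantor_set_def)
  define c where "c = (\<lambda>j. if j < k then b j else a (j - k))"
  have "x = (\<Sum>j<k + l. c j * M ^ j)"
    unfolding x sum_lessThan_add_split by (simp add: c_def sum_distrib_left power_add mult_ac)
  moreover have "\<forall>j<k + l. c j \<in> A" using a b by (auto simp: c_def)
  ultimately show "x \<in> cantor_set M A (k + l)"
    unfolding cantor_set_def by blast
qed

lemma cantor_set_0 [simp]: "cantor_set M A 0 = {0}"
  by (auto simp: cantor_set_def)

lemma cantor_set_1: "cantor_set M A (Suc 0) = A"
proof
  show "A \<subseteq> cantor_set M A (Suc 0)"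
    unfolding cantor_set_def by (auto intro: exI[of _ "\<lambda>_. _"])
qed (auto simp: cantor_set_def)

lemma cantor_set_Suc:
  "cantor_set M A (Suc k) = (\<lambda>(a, b). M ^ k * a + b) ` (A \<times> cantor_set M A k)"
  using cantor_set_add[of M A k "Suc 0"] by (simp add: cantor_set_1)

lemma cantor_set_subset:
  assumes "A \<subseteq> {..<M}"
  shows "cantor_set M A k \<subseteq> {..<M ^ k}"
proof (induction k)
  case (Suc k)
  show ?case
  proof
    fix x assume "x \<in> cantor_set M A (Suc k)"
    then obtain a b where "a \<in> A" "b \<in> cantor_set M A k" and x: "x = M ^ k * a + b"
      unfolding cantor_set_Suc by auto
    then have "a < M" "b < M ^ k" using assms Suc by auto
    have "x < M ^ k * (a + 1)" using x \<open>b < M ^ k\<close> by simp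
    also have "\<dots> \<le> M ^ k * M" using \<open>a < M\<close> by (intro mult_le_mono) auto
    finally show "x \<in> {..<M ^ Suc k}" by (simp add: mult.commute)
  qed
qed simp

lemma finite_cantor_set:
  assumes "finite A"
  shows "finite (cantor_set M A k)"
  by (induction k) (simp_all add: cantor_set_Suc assms)

lemma card_cantor_set_le:
  assumes "finite A"
  shows "card (cantor_set M A k) \<le> card A ^ k"
proof (induction k)
  case (Suc k)
  have "card (cantor_set M A (Suc k)) \<le> card (A \<times> cantor_set M A k)"
    unfolding cantor_set_Suc by (rule card_image_le) (simp add: assms finite_cantor_set)
  also have "\<dots> \<le> card A * card A ^ k"
    using Suc by (simp add: card_cartesian_product)
  finally show ?case by simp
qed simp

lemma cantor_set_nonempty:
  assumes "A \<noteq> {}"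
  shows "cantor_set M A k \<noteq> {}"
  by (induction k) (simp_all add: cantor_set_Suc assms)

lemma sum_cantor_set_add:
  assumes "A \<subseteq> {..<M}"
  shows "(\<Sum>x\<in>cantor_set M A (k + l). f x)
           = (\<Sum>a\<in>cantor_set M A l. \<Sum>b\<in>cantor_set M A k. f (M ^ k * a + b))"
proof -
  have inj: "inj_on (\<lambda>(a, b). M ^ k * a + b) (cantor_set M A l \<times> cantor_set M A k)"
  proof (rule inj_onI, clarify)
    fix a b a' b'
    assume "b \<in> cantor_set M A k" "b' \<in> cantor_set M A k"
      and eq: "M ^ k * a + b = M ^ k * a' + b'"
    then have b: "b < M ^ k" "b' < M ^ k" using cantor_set_subset[OF assms, of k] by auto
    have "(K * q + r) div K = q" if "r < K" for K q r :: nat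
      using that by auto
    from this[OF b(1), of a] this[OF b(2), of a'] show "a = a' \<and> b = b'" using eq by auto
  qed
  show ?thesis
    unfolding cantor_set_add sum.reindex[OF inj]
    by (simp add: sum.cartesian_product case_prod_unfold)
qed

section \<open>Submultiplicativity and the exponent\<close>

text \<open>
  The Cooley--Tukey factorization: with \<open>N = K * L\<close>, write the input as \<open>K * a + b\<close> and the output as
  \<open>L * c + d\<close>. Modulo \<open>N\<close> their product is \<open>L * b * c + b * d + K * a * d\<close>. So the full
  transform is a transform of length \<open>L\<close> from \<open>a\<close> to \<open>d\<close> for each fixed \<open>b\<close>, then a twiddle factor depending on \<open>b\<close>
  and \<open>d\<close>, then a transform of length \<open>K\<close> from \<open>b\<close> to \<open>c\<close> for each fixed \<open>d\<close>. On the Cantor set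
  \<open>a\<close> and \<open>d\<close> range over the set of level \<open>l\<close>, while \<open>b\<close> and \<open>c\<close> range over the set of level \<open>k\<close>.
\<close>

lemma cantor_norm_add_le:
  assumes A: "A \<subseteq> {..<M}" and M: "M > 0"
  shows "cantor_norm M A (k + l) \<le> cantor_norm M A k * cantor_norm M A l"
proof -
  define C where "C = cantor_set M A k"
  define D where "D = cantor_set M A l"
  define K where "K = M ^ k"
  define L where "L = M ^ l"
  let ?X = "cantor_set M A (k + l)"
  let ?N = "K * L"
  have pos: "K > 0" "L > 0" using M by (simp_all add: K_def L_def)
  have CK: "C \<subseteq> {..<K}" and DL: "D \<subseteq> {..<L}"
    using cantor_set_subset[OF A] by (simp_all add: C_def D_def K_def L_def)
  have X: "?X \<subseteq> {..<?N}"
    using cantor_set_subset[OF A, of "k + l"] by (simp add: K_def L_def power_add)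
  define r where "r = cantor_norm M A k"
  define s where "s = cantor_norm M A l"
  have r: "r = l2_opnorm K (masked_dft K C)"
    and s: "s = l2_opnorm L (masked_dft L D)"
    by (simp_all add: r_def s_def cantor_norm_def C_def D_def K_def L_def)
  have nonneg: "r \<ge> 0" "s \<ge> 0"
    using masked_opnorm_nonneg pos CK DL by (simp_all add: r s)
  have in_sum: "(\<Sum>x\<in>?X. f x) = (\<Sum>a\<in>D. \<Sum>b\<in>C. f (K * a + b))" for f :: "nat \<Rightarrow> 'b :: comm_monoid_add"
    unfolding C_def D_def K_def by (rule sum_cantor_set_add[OF A])
  have out_sum: "(\<Sum>x\<in>?X. f x) = (\<Sum>c\<in>C. \<Sum>d\<in>D. f (L * c + d))" for f :: "nat \<Rightarrow> 'b :: comm_monoid_add"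
    unfolding C_def D_def L_def add.commute[of k l] by (rule sum_cantor_set_add[OF A])
  have "l2_opnorm ?N (masked_dft ?N ?X) \<le> r * s"
  proof (rule masked_opnorm_le[OF X])
    fix u :: "nat \<Rightarrow> complex"
    define w where "w = (\<lambda>b d. restricted_dft L D (\<lambda>a. u (K * a + b)) d)"
    define w' where "w' = (\<lambda>d b. unity_root ?N b ^ d * w b d)"
    have split: "restricted_dft ?N ?X u (L * c + d) = restricted_dft K C (w' d) c" for c d
    proof -
      have char: "unity_root ?N (K * a + b) ^ (L * c + d)
          = unity_root K b ^ c * (unity_root ?N b ^ d * unity_root L a ^ d)" for a b
      proof -
        have "unity_root ?N (K * a + b) ^ (L * c + d)
            = cis (- (2 * pi * ((L * c + d) * (K * a + b)) / (real K * real L)))"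
          by (simp add: unity_root_power)
        also have "- (2 * pi * ((L * c + d) * (K * a + b)) / (real K * real L))
            = - (2 * pi * (real c * real b) / real K) + (- (2 * pi * (real d * real b) / (real K * real L))
               + - (2 * pi * (real d * real a) / real L)) + - (2 * pi * real (c * a))"
          using pos by (simp add: field_simps)
        also have "cis \<dots> = unity_root K b ^ c * (unity_root ?N b ^ d * unity_root L a ^ d)
             * cis (- (2 * pi * real (c * a)))"
          by (simp only: unity_root_power of_nat_mult cis_mult)
        \<comment> \<open>The term \<open>K * L * (a * c)\<close> of the product is a multiple of \<open>N\<close>.\<close>
        also have "cis (- (2 * pi * real (c * a))) = 1"
          using unity_root_power_order[of 1 "c * a"] by (simp add: unity_root_def)
        finally show ?thesis by simp
      qed
      have "restricted_dft ?N ?X u (L * c + d)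
          = (\<Sum>b\<in>C. \<Sum>a\<in>D. unity_root K b ^ c * (unity_root ?N b ^ d * unity_root L a ^ d) * u (K * a + b))
             / (complex_of_real (sqrt (real K)) * complex_of_real (sqrt (real L)))"
        unfolding restricted_dft_def in_sum
        by (subst sum.swap) (simp add: char real_sqrt_mult)
      also have "\<dots> = restricted_dft K C (w' d) c"
        by (simp add: restricted_dft_def w'_def w_def sum_distrib_left sum_divide_distrib mult_ac)
      finally show ?thesis .
    qed
    have "(\<Sum>j\<in>?X. (cmod (restricted_dft ?N ?X u j))\<^sup>2)
        = (\<Sum>d\<in>D. \<Sum>c\<in>C. (cmod (restricted_dft K C (w' d) c))\<^sup>2)"
      unfolding out_sum split by (rule sum.swap)
    also have "\<dots> \<le> (\<Sum>d\<in>D. r\<^sup>2 * (\<Sum>b\<in>C. (cmod (w' d b))\<^sup>2))"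
      unfolding r by (intro sum_mono masked_opnorm_bound pos CK)
    also have "\<dots> = r\<^sup>2 * (\<Sum>b\<in>C. \<Sum>d\<in>D. (cmod (w b d))\<^sup>2)"
      unfolding sum_distrib_left[symmetric]
      by (subst sum.swap) (simp add: w'_def norm_mult norm_power)
    also have "\<dots> \<le> r\<^sup>2 * (\<Sum>b\<in>C. s\<^sup>2 * (\<Sum>a\<in>D. (cmod (u (K * a + b)))\<^sup>2))"
      unfolding w_def s by (intro mult_left_mono sum_mono masked_opnorm_bound pos DL) simp
    also have "\<dots> = (r * s)\<^sup>2 * (\<Sum>b\<in>C. \<Sum>a\<in>D. (cmod (u (K * a + b)))\<^sup>2)"
      by (simp add: power_mult_distrib mult.assoc flip: sum_distrib_left)
    also have "(\<Sum>b\<in>C. \<Sum>a\<in>D. (cmod (u (K * a + b)))\<^sup>2) = (\<Sum>l\<in>?X. (cmod (u l))\<^sup>2)"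
      unfolding in_sum by (rule sum.swap)
    finally show "(\<Sum>j\<in>?X. (cmod (restricted_dft ?N ?X u j))\<^sup>2)
        \<le> (r * s)\<^sup>2 * (\<Sum>l\<in>?X. (cmod (u l))\<^sup>2)" .
  qed (use nonneg in simp)
  then show ?thesis
    by (simp add: r_def s_def cantor_norm_def K_def L_def power_add)
qed

text \<open>
  Fekete's lemma: the limit is the infimum. If \<open>a m / m\<close> is close to the infimum, then division with remainder by
  \<open>m\<close> bounds \<open>a n / n\<close> by \<open>a m / m\<close> up to an error \<open>D / n\<close>, where \<open>D\<close> depends on \<open>m\<close> only.
\<close>

lemma fekete:
  fixes a :: "nat \<Rightarrow> real"
  assumes sub: "\<And>m n. a (m + n) \<le> a m + a n"
    and lower: "\<And>n. - C * real n \<le> a n"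
  obtains L where "(\<lambda>n. a n / real n) \<longlonglongrightarrow> L" and "\<And>n. n > 0 \<Longrightarrow> L \<le> a n / real n"
proof
  let ?f = "\<lambda>n. a n / real n"
  define L where "L = (INF n\<in>{0<..}. ?f n)"
  have bdd: "bdd_below (?f ` {0<..})"
    by (rule bdd_belowI[of _ "- C"]) (use lower in \<open>auto simp: le_divide_eq\<close>)
  show L_le: "L \<le> ?f n" if "n > 0" for n
    unfolding L_def using that by (intro cINF_lower bdd) auto
  show "?f \<longlonglongrightarrow> L"
  proof (rule order_tendstoI)
    fix l assume "l < L"
    then show "\<forall>\<^sub>F n in sequentially. l < ?f n"
      using L_le by (intro eventually_mono[OF eventually_gt_at_top[of 0]]) (auto intro: less_le_trans)
  next
    fix h assume "L < h"
    then obtain m where m: "m > 0" "?f m < h"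
      unfolding L_def using bdd by (subst (asm) cINF_less_iff) auto
    have multiple: "a (q * m + r) \<le> real q * a m + a r" for q r
    proof (induction q)
      case (Suc q)
      have "a (Suc q * m + r) \<le> a m + a (q * m + r)"
        using sub[of m "q * m + r"] by (simp add: add.assoc)
      with Suc show ?case by (simp add: algebra_simps)
    qed simp
    define D where "D = \<bar>a m\<bar> + (\<Sum>r<m. \<bar>a r\<bar>)"
    have upper: "?f n \<le> ?f m + D / real n" if "n > 0" for n
    proof -
      define q r where "q = n div m" and "r = n mod m"
      have n: "n = q * m + r" and "r < m"
        using m by (simp_all add: q_def r_def)
      \<comment> \<open>Rounding \<open>n\<close> down to a multiple of \<open>m\<close> changes the main term by at most \<open>\<bar>a m\<bar>\<close>.\<close>
      have "real q * a m = real n * ?f m - real r * ?f m"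
        using m by (simp add: n field_simps)
      also have "- (real r * ?f m) \<le> \<bar>a m\<bar>"
      proof -
        have "\<bar>real r * ?f m\<bar> = (real r / real m) * \<bar>a m\<bar>"
          by (simp add: abs_mult)
        also have "\<dots> \<le> 1 * \<bar>a m\<bar>"
          using \<open>r < m\<close> by (intro mult_right_mono) simp_all
        finally show ?thesis by linarith
      qed
      then have "real n * ?f m - real r * ?f m \<le> real n * ?f m + \<bar>a m\<bar>"
        by linarith
      finally have "real q * a m \<le> real n * ?f m + \<bar>a m\<bar>" .
      moreover have "\<bar>a r\<bar> \<le> (\<Sum>r<m. \<bar>a r\<bar>)"
        using \<open>r < m\<close> by (intro member_le_sum) auto
      moreover have "a n \<le> real q * a m + a r"
        using multiple[of q r] by (simp flip: n)
      ultimately have "a n \<le> real n * ?f m + D"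
        unfolding D_def by linarith
      then have "?f n \<le> (real n * ?f m + D) / real n"
        by (rule divide_right_mono) simp
      also have "\<dots> = ?f m + D / real n"
        using that by (simp add: add_divide_distrib)
      finally show ?thesis .
    qed
    have "(\<lambda>n. D / real n) \<longlonglongrightarrow> 0"
      by (rule lim_const_over_n)
    then have "\<forall>\<^sub>F n in sequentially. D / real n < h - ?f m"
      using m by (intro order_tendstoD) auto
    then show "\<forall>\<^sub>F n in sequentially. ?f n < h"
      using eventually_gt_at_top[of 0]
    proof eventually_elim
      case (elim n)
      with upper[of n] show ?case by linarith
    qed
  qed
qed

lemma cantor_norm_lower:
  assumes "A \<subseteq> {..<M}" "A \<noteq> {}"
  shows "cantor_norm M A k \<ge> 1 / sqrt (real M ^ k)"
proof -
  have "M > 0" using assms by auto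
  moreover obtain x where "x \<in> cantor_set M A k" using cantor_set_nonempty[OF assms(2)] by blast
  ultimately show ?thesis
    using masked_opnorm_lower[of "M ^ k" "cantor_set M A k" x] cantor_set_subset[OF assms(1)]
    by (simp add: cantor_norm_def)
qed

lemma cantor_norm_pos:
  assumes "A \<subseteq> {..<M}" "A \<noteq> {}"
  shows "cantor_norm M A k > 0"
proof -
  have "0 < 1 / sqrt (real M ^ k)" using assms by (cases "M = 0") auto
  also note cantor_norm_lower[OF assms]
  finally show ?thesis .
qed

lemma fup_exponent_lower:
  assumes A: "A \<subseteq> {..<M}" "A \<noteq> {}" and M: "M > 1" and k: "k > 0"
  shows "- (ln (cantor_norm M A k) / (real k * ln (real M))) \<le> fup_exponent M A"
proof -
  let ?a = "\<lambda>k. ln (cantor_norm M A k)"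
  have pos: "cantor_norm M A j > 0" for j by (rule cantor_norm_pos[OF A])
  have lnM: "ln (real M) > 0" using M by simp
  have sub: "?a (m + n) \<le> ?a m + ?a n" for m n
  proof -
    have "?a (m + n) \<le> ln (cantor_norm M A m * cantor_norm M A n)"
      using pos M by (simp add: cantor_norm_add_le[OF A(1)])
    also have "\<dots> = ?a m + ?a n" using pos by (simp add: ln_mult_pos)
    finally show ?thesis .
  qed
  have lower: "- (ln (real M) / 2) * real n \<le> ?a n" for n
  proof -
    have "ln (1 / sqrt (real M ^ n)) \<le> ?a n"
      using cantor_norm_lower[OF A, of n] pos M by (intro ln_mono) auto
    then show ?thesis
      using M by (simp add: ln_div ln_sqrt ln_realpow mult.commute)
  qed
  obtain l where lim: "(\<lambda>n. ?a n / real n) \<longlonglongrightarrow> l" and le: "\<And>n. n > 0 \<Longrightarrow> l \<le> ?a n / real n"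
    using fekete[of ?a, OF sub lower] by blast
  have "(\<lambda>n. ?a n / real n / ln (real M)) \<longlonglongrightarrow> l / ln (real M)"
    using lnM by (intro tendsto_divide lim tendsto_const) auto
  then have "fup_exponent M A = - (l / ln (real M))"
    by (simp add: fup_exponent_def limI)
  moreover have "l / ln (real M) \<le> ?a k / real k / ln (real M)"
    using le[OF k] lnM by (intro divide_right_mono) auto
  ultimately show ?thesis by simp
qed

section \<open>A cyclic interval outside the Cantor set\<close>

text \<open>
  If every element of \<open>A\<close> had another one at most \<open>L\<close> steps ahead, the blocks
  \<open>{a, \<dots>, a + L - 1}\<close> with \<open>a\<close> in \<open>A\<close> would cover all residues modulo \<open>M\<close>, which is impossible
  because they contain at most \<open>card A * L\<close> residues.
\<close>

lemma cyclic_gap: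
  assumes A: "A \<subseteq> {..<M}" "A \<noteq> {}" and L: "card A * L < M"
  obtains a where "a \<in> A" and "\<And>i. 1 \<le> i \<Longrightarrow> i \<le> L \<Longrightarrow> (a + i) mod M \<notin> A"
proof -
  have "\<exists>a\<in>A. \<forall>i. 1 \<le> i \<and> i \<le> L \<longrightarrow> (a + i) mod M \<notin> A"
  proof (rule ccontr)
    assume "\<not> ?thesis"
    then have near: "\<exists>i. 1 \<le> i \<and> i \<le> L \<and> (a + i) mod M \<in> A" if "a \<in> A" for a
      using that by blast
    obtain b where b: "b \<in> A" using A by blast
    have "L > 0" using near[OF b] by auto
    have cover: "\<exists>a\<in>A. \<exists>i<L. (b + t) mod M = (a + i) mod M" for t
    proof (induction t)
      case 0
      show ?case using b \<open>L > 0\<close> by blast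
    next
      case (Suc t)
      then obtain a i where a: "a \<in> A" "i < L" and eq: "(b + t) mod M = (a + i) mod M" by blast
      have step: "(b + Suc t) mod M = (a + Suc i) mod M"
        using mod_Suc_eq[of "b + t" M] mod_Suc_eq[of "a + i" M] eq by simp
      show ?case
      proof (cases "Suc i < L")
        case True
        with step a show ?thesis by blast
      next
        case False
        \<comment> \<open>The block of \<open>a\<close> is exhausted, so the next element of \<open>A\<close> takes over.\<close>
        with a have i: "Suc i = L" by simp
        obtain j where j: "1 \<le> j" "j \<le> L" "(a + j) mod M \<in> A" using near[OF a(1)] by blast
        have "(a + Suc i) mod M = ((a + j) + (L - j)) mod M" using j i by simp
        also have "\<dots> = ((a + j) mod M + (L - j)) mod M" by (simp only: mod_add_left_eq)
        finally have "(b + Suc t) mod M = ((a + j) mod M + (L - j)) mod M" using step by simp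
        moreover have "L - j < L" using j \<open>L > 0\<close> by simp
        ultimately show ?thesis using j by blast
      qed
    qed
    have "{..<M} \<subseteq> (\<lambda>(a, i). (a + i) mod M) ` (A \<times> {..<L})"
    proof
      fix x assume x: "x \<in> {..<M}"
      have "b < M" using b A by auto
      then have "(b + (x + M - b)) mod M = x" using x by simp
      with cover[of "x + M - b"] show "x \<in> (\<lambda>(a, i). (a + i) mod M) ` (A \<times> {..<L})"
        by force
    qed
    moreover have fin: "finite (A \<times> {..<L})" using A finite_subset by blast
    ultimately have "card {..<M} \<le> card (A \<times> {..<L})"
      using surj_card_le by blast
    with L show False by (simp add: card_cartesian_product)
  qed
  then show ?thesis using that by blast
qed

text \<open>
  The leading digit \<open>a + 1 + t div M ^ k\<close> of this residue, taken modulo \<open>M\<close>, stays in the gap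
  of \<open>A\<close> for all these \<open>t\<close>.
\<close>

lemma cantor_set_cyclic_gap:
  assumes A: "A \<subseteq> {..<M}"
    and gap: "\<And>i. 1 \<le> i \<Longrightarrow> i \<le> L \<Longrightarrow> (a + i) mod M \<notin> A"
    and t: "t < L * M ^ k"
  shows "((a + 1) * M ^ k + t) mod M ^ Suc k \<notin> cantor_set M A (Suc k)"
proof
  define K where "K = M ^ k"
  define y where "y = (a + 1) * K + t"
  have K: "K > 0" using t[folded K_def] by (cases K) auto
  assume "((a + 1) * M ^ k + t) mod M ^ Suc k \<in> cantor_set M A (Suc k)"
  then have "y mod (K * M) \<in> (\<lambda>(d, b). K * d + b) ` (A \<times> cantor_set M A k)"
    by (simp add: y_def K_def cantor_set_Suc mult.commute)
  then obtain d b where d: "d \<in> A" and b: "b \<in> cantor_set M A k" and y: "y mod (K * M) = K * d + b"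
    by auto
  have "b < K" using b cantor_set_subset[OF A, of k] by (auto simp: K_def)
  then have "d = y mod (K * M) div K" using y K by simp
  also have "\<dots> = y div K mod M"
    using K by (simp add: mod_mult2_eq)
  also have "y div K = a + (1 + t div K)"
  proof -
    have "(t + (a + 1) * K) div K = (a + 1) + t div K"
      using K by (intro div_mult_self1) simp
    then show ?thesis by (simp only: y_def ac_simps)
  qed
  finally have "(a + (1 + t div K)) mod M \<in> A" using d by simp
  moreover have "t div K < L" using t by (simp add: K_def less_mult_imp_div_less)
  ultimately show False using gap[of "1 + t div K"] by simp
qed

text \<open>
  The gap has \<open>L * M ^ k\<close> elements, at least as many as \<open>card A ^ Suc k\<close> and hence as the Cantor set, so the
  energy estimate applies at the start \<open>(a + 1) * M ^ k\<close> of the gap.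
\<close>

lemma cantor_norm_gap:
  assumes A: "A \<subseteq> {..<M}" "A \<noteq> {}" and L: "card A * L < M"
    and size: "card A ^ Suc k \<le> L * M ^ k"
  shows "(cantor_norm M A (Suc k))\<^sup>2 \<le> 1 - 1 / 4 ^ (M ^ Suc k)"
proof -
  let ?N = "M ^ Suc k" and ?X = "cantor_set M A (Suc k)"
  have N: "?N > 0" using A by (cases "M = 0") auto
  have finA: "finite A" using A finite_subset by blast
  have X: "?X \<subseteq> {..<?N}" by (rule cantor_set_subset[OF A(1)])
  obtain a where gap: "\<And>i. 1 \<le> i \<Longrightarrow> i \<le> L \<Longrightarrow> (a + i) mod M \<notin> A"
    using cyclic_gap[OF A L] by metis
  have avoid: "((a + 1) * M ^ k + t) mod ?N \<notin> ?X" if "t < card ?X" for t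
    using that card_cantor_set_le[OF finA, of M "Suc k"] size
    by (intro cantor_set_cyclic_gap[OF A(1) gap]) auto
  define c where "c = sqrt (1 - 1 / 4 ^ ?N)"
  have c: "c \<ge> 0" "c\<^sup>2 = 1 - 1 / 4 ^ ?N" by (simp_all add: c_def)
  have "cantor_norm M A (Suc k) \<le> c"
    unfolding cantor_norm_def
  proof (rule masked_opnorm_le[OF X c(1)])
    show "(\<Sum>j\<in>?X. (cmod (restricted_dft ?N ?X u j))\<^sup>2) \<le> c\<^sup>2 * (\<Sum>l\<in>?X. (cmod (u l))\<^sup>2)" for u
      unfolding c(2) by (rule restricted_dft_energy_gap[OF N X avoid])
  qed
  then have "(cantor_norm M A (Suc k))\<^sup>2 \<le> c\<^sup>2"
    using cantor_norm_pos[OF A, of "Suc k"] by (intro power_mono) auto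
  with c show ?thesis by simp
qed

text \<open>
  Since \<open>M powr (1 - \<delta>) = M / m\<close>, the threshold is the logarithmic form of
  \<open>(M / m) ^ k \<ge> M / L\<close> with \<open>L = \<lceil>M / m - 1\<rceil>\<close>. It excludes \<open>k = 0\<close> because \<open>L < M\<close>.
\<close>

lemma threshold_imp_size:
  fixes M m k :: nat and \<delta> :: real
  assumes m: "0 < m" "m < M" and \<delta>: "\<delta> = ln (real m) / ln (real M)"
    and k: "real k \<ge> 1 / (1 - \<delta>)
           - ln (real_of_int \<lceil>real M powr (1 - \<delta>) - 1\<rceil>) / ((1 - \<delta>) * ln (real M))"
  obtains L where "m * L < M" and "k > 0" and "m ^ k \<le> L * M ^ (k - 1)"
proof
  define q where "q = real M / real m"
  define L where "L = nat \<lceil>q - 1\<rceil>"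
  have q: "q > 1" using m by (simp add: q_def)
  have lnM: "ln (real M) > 0" using m by simp
  have lnq: "(1 - \<delta>) * ln (real M) = ln q"
    using m lnM by (simp add: \<delta> q_def ln_div field_simps)
  have lnq_pos: "ln q > 0" using q by simp
  have "real M powr (1 - \<delta>) = exp (ln q)"
    using m by (simp add: powr_def lnq)
  then have powr: "real M powr (1 - \<delta>) = q" using q by simp
  have "\<lceil>q - 1\<rceil> > 0" using q by simp
  then have L: "real_of_int \<lceil>q - 1\<rceil> = real L" "L > 0" by (simp_all add: L_def)
  have "real L < q" unfolding L(1)[symmetric] by linarith
  then have "real (m * L) < real M"
    using m by (simp add: q_def field_simps)
  then show mL: "m * L < M" by (simp only: of_nat_less_iff)
  have delta: "1 / (1 - \<delta>) = ln (real M) / ln q"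
    unfolding lnq[symmetric] using lnM by simp
  have "real k \<ge> (ln (real M) - ln (real L)) / ln q"
    using k unfolding powr L(1) lnq delta by (simp add: diff_divide_distrib)
  then have k': "real k * ln q \<ge> ln (real M) - ln (real L)"
    using lnq_pos by (simp add: divide_le_eq)
  have "L < M" using mL m by (metis le_less_trans mult.commute mult_le_mono1 nat_mult_1 Suc_leI One_nat_def)
  then have "ln (real L) < ln (real M)" using L by simp
  then show kpos: "k > 0" using k' by (cases k) auto
  have "ln (real M) \<le> ln (q ^ k * real L)"
    using k' q L by (simp add: ln_mult_pos ln_realpow)
  then have "real M \<le> q ^ k * real L"
    using q L m by simp
  then have "real M * real m ^ k \<le> real L * real M ^ k"
    using m by (simp add: q_def power_divide field_simps)
  also have "real M ^ k = real M * real M ^ (k - 1)"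
    using kpos by (simp add: power_eq_if)
  finally have "real m ^ k \<le> real L * real M ^ (k - 1)"
    using m by simp
  then have "real (m ^ k) \<le> real (L * M ^ (k - 1))"
    by simp
  then show "m ^ k \<le> L * M ^ (k - 1)" by (simp only: of_nat_le_iff)
qed

section \<open>The lower bound on the fractal uncertainty exponent\<close>

theorem corollary3p7:
  fixes M k :: nat and A :: "nat set" and \<delta> \<beta> :: real
  assumes "A \<subseteq> {0..<M}" and "1 < card A" and "card A < M"
    and "\<delta> = ln (real (card A)) / ln (real M)"
    and "\<beta> = fup_exponent M A"
    and "real k \<ge> 1 / (1 - \<delta>)
           - ln (real_of_int \<lceil>real M powr (1 - \<delta>) - 1\<rceil>) / ((1 - \<delta>) * ln (real M))"
  shows "\<beta> \<ge> - (ln (cantor_norm M A k) / (real k * ln (real M)))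
       \<and> - (ln (cantor_norm M A k) / (real k * ln (real M)))
           \<ge> 2 powr (- 2 * real M ^ k) / (2 * real k * ln (real M))
       \<and> 2 powr (- 2 * real M ^ k) / (2 * real k * ln (real M)) > 0"
proof -
  have A: "A \<subseteq> {..<M}" "A \<noteq> {}"
    using assms(1,2) by (auto simp: atLeast0LessThan)
  have M: "M > 1" and m: "0 < card A" using assms(2,3) by auto
  obtain L where L: "card A * L < M" "k > 0" "card A ^ k \<le> L * M ^ (k - 1)"
    using threshold_imp_size[OF m assms(3,4,6)] by metis
  define r where "r = cantor_norm M A k"
  have r: "r > 0" unfolding r_def by (rule cantor_norm_pos[OF A])
  have den: "real k * ln (real M) > 0" using L M by simp
  have powr: "2 powr (- 2 * real M ^ k) = 1 / 4 ^ (M ^ k)"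
  proof -
    have "2 powr (- 2 * real M ^ k) = 1 / (2 powr real (2 * M ^ k))"
      by (simp add: powr_minus_divide)
    also have "2 powr real (2 * M ^ k) = 4 ^ (M ^ k)"
      by (subst powr_realpow) (simp_all add: power_mult)
    finally show ?thesis .
  qed
  have "r\<^sup>2 \<le> 1 - 1 / 4 ^ (M ^ k)"
    using cantor_norm_gap[OF A L(1), of "k - 1"] L(2,3) by (simp add: r_def)
  then have "ln (r\<^sup>2) \<le> ln (1 - 1 / 4 ^ (M ^ k))"
    using r by (intro ln_mono) auto
  then have "2 * ln r \<le> ln (1 - 1 / 4 ^ (M ^ k))"
    using r by (simp add: ln_realpow)
  also have "\<dots> \<le> - (1 / 4 ^ (M ^ k))"
    using ln_le_minus_one[of "1 - 1 / 4 ^ (M ^ k)"] M by simp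
  finally have "1 / 4 ^ (M ^ k) / 2 \<le> - ln r" by simp
  then have "1 / 4 ^ (M ^ k) / 2 / (real k * ln (real M)) \<le> - ln r / (real k * ln (real M))"
    using den by (intro divide_right_mono) auto
  moreover have "- (ln r / (real k * ln (real M))) \<le> \<beta>"
    unfolding assms(5) r_def by (rule fup_exponent_lower[OF A M L(2)])
  ultimately show ?thesis
    unfolding powr r_def using den by (simp add: mult.assoc)
qed

end
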